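(* Let $(S,\vee_S)$ be a join semilattice and let $\sqsubseteq$ be a binary relation on $S$. Then $(S,\vee_S,\sqsubseteq)$ is a specialization semilattice if and only if there are a join semilattice $(T,\vee_T)$ and a semilattice homomorphism $\varphi:(S,\vee_S)\to(T,\vee_T)$ such that, for all $a,b\in S$, $a\sqsubseteq b$ if and only if $\varphi(a)\leq_T\varphi(b)$.
   Context: In a join semilattice $(T,\vee_T)$, $\leq_T$ is the induced partial order: $x\leq_T y$ iff $x\vee_T y=y$. A specialization semilattice is a triple $(S,\vee,\sqsubseteq)$ where $(S,\vee)$ is a join semilattice and $\sqsubseteq$ is a preorder (reflexive and transitive relation) on $S$ which is coarser than the order $\leq$ induced by $\vee$ (that is, $a\leq b$ implies $a\sqsubseteq b$) and such that, for all $a,a_1,b\in S$, $a\sqsubseteq b$ and $a_1\sqsubseteq b$ imply $a\vee a_1\sqsubseteq b$. *)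

theory Defs
  imports Main
begin

text \<open>
  Structures live on explicit carrier sets, so that a semilattice can be quantified over inside a
  formula; operations and relations are only constrained on the carrier. Carriers may be empty.
  If one requires nonempty semilattices, nothing changes for a nonempty \<open>S\<close>, since any \<open>T\<close>
  receiving a homomorphism from \<open>S\<close> is then nonempty as well.
\<close>

locale join_semilattice_on =
  fixes S :: "'a set" and join :: "'a \<Rightarrow> 'a \<Rightarrow> 'a"
  assumes join_closed: "\<lbrakk>a \<in> S; b \<in> S\<rbrakk> \<Longrightarrow> join a b \<in> S"
    and join_assoc: "\<lbrakk>a \<in> S; b \<in> S; c \<in> S\<rbrakk> \<Longrightarrow> join (join a b) c = join a (join b c)"
    and join_commute: "\<lbrakk>a \<in> S; b \<in> S\<rbrakk> \<Longrightarrow> join a b = join b a"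
    and join_idem: "a \<in> S \<Longrightarrow> join a a = a"

definition join_le :: "('a \<Rightarrow> 'a \<Rightarrow> 'a) \<Rightarrow> 'a \<Rightarrow> 'a \<Rightarrow> bool" where
  "join_le join x y \<longleftrightarrow> join x y = y"

definition semilattice_hom_on ::
  "'a set \<Rightarrow> ('a \<Rightarrow> 'a \<Rightarrow> 'a) \<Rightarrow> 'b set \<Rightarrow> ('b \<Rightarrow> 'b \<Rightarrow> 'b) \<Rightarrow> ('a \<Rightarrow> 'b) \<Rightarrow> bool" where
  "semilattice_hom_on S joinS T joinT \<phi> \<longleftrightarrow>
     (\<forall>a\<in>S. \<phi> a \<in> T) \<and>
     (\<forall>a\<in>S. \<forall>b\<in>S. \<phi> (joinS a b) = joinT (\<phi> a) (\<phi> b))"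

locale specialization_semilattice = join_semilattice_on S join
  for S :: "'a set" and join :: "'a \<Rightarrow> 'a \<Rightarrow> 'a" +
  fixes spec :: "'a \<Rightarrow> 'a \<Rightarrow> bool"
  assumes spec_refl: "reflp_on S spec"
    and spec_trans: "transp_on S spec"
    and spec_coarser: "\<lbrakk>a \<in> S; b \<in> S; join_le join a b\<rbrakk> \<Longrightarrow> spec a b"
    and spec_join: "\<lbrakk>a \<in> S; a1 \<in> S; b \<in> S; spec a b; spec a1 b\<rbrakk> \<Longrightarrow> spec (join a a1) b"

end

theory Submission
  imports Defs
begin

text \<open>
  A preorder pulled back from the order of a join semilattice along a homomorphism inherits
  the specialization axioms, because in \<open>T\<close> an element lies above \<open>\<phi> (a \<or> b) = \<phi> a \<or> \<phi> b\<close>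
  exactly when it lies above both \<open>\<phi> a\<close> and \<open>\<phi> b\<close> (\<open>specialization_semilattice_pullback\<close>).

  Conversely, a preorder is represented faithfully by its principal up-sets
  \<open>{c. a \<sqsubseteq> c}\<close> ordered by reverse inclusion, an order whose join is intersection. Given transitivity,
  the two axioms linking \<open>\<sqsubseteq>\<close> to the join say together that \<open>a \<or> b \<sqsubseteq> c\<close> holds exactly when
  \<open>a \<sqsubseteq> c\<close> and \<open>b \<sqsubseteq> c\<close>, that is, that passing to principal up-sets turns joins into
  intersections (\<open>upset_join\<close>). Up-sets rather than down-sets are needed here: the down-set
  of \<open>a \<or> b\<close> is in general not the union of those of \<open>a\<close> and \<open>b\<close>, so with
  down-sets the join of \<open>T\<close> would have to be union followed by a closure.
\<close>

lemma specialization_semilattice_pullback: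
  assumes S: "join_semilattice_on S joinS"
    and T: "join_semilattice_on T joinT"
    and hom: "semilattice_hom_on S joinS T joinT \<phi>"
    and spec: "\<And>a b. \<lbrakk>a \<in> S; b \<in> S\<rbrakk> \<Longrightarrow> spec a b \<longleftrightarrow> join_le joinT (\<phi> a) (\<phi> b)"
  shows "specialization_semilattice S joinS spec"
proof -
  interpret S: join_semilattice_on S joinS by (fact S)
  interpret T: join_semilattice_on T joinT by (fact T)
  have mem: "\<phi> a \<in> T" if "a \<in> S" for a
    using hom that by (simp add: semilattice_hom_on_def)
  have map_join: "\<phi> (joinS a b) = joinT (\<phi> a) (\<phi> b)" if "a \<in> S" "b \<in> S" for a b
    using hom that by (simp add: semilattice_hom_on_def)
  show ?thesis
  proof
    show "reflp_on S spec"
      by (rule reflp_onI) (simp add: spec join_le_def mem T.join_idem)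
    show "transp_on S spec"
    proof (rule transp_onI)
      fix a b c
      assume "a \<in> S" "b \<in> S" "c \<in> S" "spec a b" "spec b c"
      then show "spec a c"
        by (metis spec join_le_def mem T.join_assoc)
    qed
    show "spec a b" if "a \<in> S" "b \<in> S" "join_le joinS a b" for a b
      using that by (metis spec join_le_def map_join)
    show "spec (joinS a a1) b"
      if "a \<in> S" "a1 \<in> S" "b \<in> S" "spec a b" "spec a1 b" for a a1 b
      using that by (simp add: spec join_le_def map_join mem S.join_closed T.join_assoc)
  qed
qed

context specialization_semilattice
begin

definition upset :: "'a \<Rightarrow> 'a set" where
  "upset a = {c \<in> S. spec a c}"

lemma spec_join_iff:
  assumes "a \<in> S" "b \<in> S" "c \<in> S"
  shows "spec (join a b) c \<longleftrightarrow> spec a c \<and> spec b c"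
proof
  assume ab: "spec (join a b) c"
  have "join_le join a (join a b)"
    using assms by (simp add: join_le_def join_assoc [symmetric] join_idem)
  moreover have "join_le join b (join a b)"
    using assms by (metis join_le_def join_assoc join_commute join_idem)
  ultimately have "spec a (join a b)" "spec b (join a b)"
    using assms by (simp_all add: spec_coarser join_closed)
  with ab show "spec a c \<and> spec b c"
    using assms join_closed spec_trans by (meson transp_onD)
next
  assume "spec a c \<and> spec b c"
  with assms show "spec (join a b) c"
    by (simp add: spec_join)
qed

lemma upset_join:
  assumes "a \<in> S" "b \<in> S"
  shows "upset (join a b) = upset a \<inter> upset b"
  using assms by (auto simp: upset_def spec_join_iff)

text \<open>
  Reflexivity puts \<open>b\<close> into its own up-set, so an inclusion between principal up-sets can be
  tested at its generator; transitivity gives the other direction. Since the join is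
  intersection, \<open>join_le\<close> is reverse inclusion.
\<close>

lemma spec_iff_upset_le:
  assumes "a \<in> S" "b \<in> S"
  shows "spec a b \<longleftrightarrow> join_le (\<inter>) (upset a) (upset b)"
proof -
  have "spec a b \<longleftrightarrow> upset b \<subseteq> upset a"
  proof
    assume ab: "spec a b"
    show "upset b \<subseteq> upset a"
    proof
      fix c
      assume "c \<in> upset b"
      then have "c \<in> S" "spec b c"
        by (simp_all add: upset_def)
      with ab have "spec a c"
        using assms by (blast intro: transp_onD [OF spec_trans])
      with \<open>c \<in> S\<close> show "c \<in> upset a"
        by (simp add: upset_def)
    qed
  next
    have "b \<in> upset b"
      using assms by (simp add: upset_def reflp_onD [OF spec_refl])
    moreover assume "upset b \<subseteq> upset a"
    ultimately have "b \<in> upset a"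
      by blast
    then show "spec a b"
      by (simp add: upset_def)
  qed
  then show ?thesis
    by (simp add: join_le_def inf.absorb_iff2)
qed

lemma semilattice_hom_upset:
  "semilattice_hom_on S join (Pow S) (\<inter>) upset"
  unfolding semilattice_hom_on_def
proof (intro conjI ballI)
  show "upset a \<in> Pow S" for a
    by (auto simp: upset_def)
qed (rule upset_join)

end

lemma join_semilattice_Pow_Int: "join_semilattice_on (Pow S) (\<inter>)"
  by standard auto

theorem corollary2p4:
  fixes S :: "'a set" and joinS :: "'a \<Rightarrow> 'a \<Rightarrow> 'a" and spec :: "'a \<Rightarrow> 'a \<Rightarrow> bool"
  assumes "join_semilattice_on S joinS"
  shows "(specialization_semilattice S joinS spec \<longleftrightarrow>
           (\<exists>(T :: 'a set set) (joinT :: 'a set \<Rightarrow> 'a set \<Rightarrow> 'a set) (\<phi> :: 'a \<Rightarrow> 'a set).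
              join_semilattice_on T joinT \<and> semilattice_hom_on S joinS T joinT \<phi> \<and>
              (\<forall>a\<in>S. \<forall>b\<in>S. spec a b \<longleftrightarrow> join_le joinT (\<phi> a) (\<phi> b))))
       \<and> ((\<exists>(T :: 'b set) (joinT :: 'b \<Rightarrow> 'b \<Rightarrow> 'b) (\<phi> :: 'a \<Rightarrow> 'b).
              join_semilattice_on T joinT \<and> semilattice_hom_on S joinS T joinT \<phi> \<and>
              (\<forall>a\<in>S. \<forall>b\<in>S. spec a b \<longleftrightarrow> join_le joinT (\<phi> a) (\<phi> b)))
           \<longrightarrow> specialization_semilattice S joinS spec)"
proof (intro conjI iffI impI)
  assume "specialization_semilattice S joinS spec"
  then interpret specialization_semilattice S joinS spec .
  show "\<exists>(T :: 'a set set) joinT \<phi>.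
      join_semilattice_on T joinT \<and> semilattice_hom_on S joinS T joinT \<phi> \<and>
      (\<forall>a\<in>S. \<forall>b\<in>S. spec a b \<longleftrightarrow> join_le joinT (\<phi> a) (\<phi> b))"
    by (intro exI [of _ "Pow S"] exI [of _ "(\<inter>)"] exI [of _ upset] conjI ballI
        join_semilattice_Pow_Int semilattice_hom_upset spec_iff_upset_le)
qed (elim exE conjE, rule specialization_semilattice_pullback [OF assms], assumption+, simp)+

end
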